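(* Let $\alpha,\beta\in\mathbb{R}$ with $\alpha+\beta>0$, $\beta>0$, and for small $\varepsilon>0$ put $\mu=\frac{\sqrt{\alpha+\beta}}{\varepsilon}$. Define $v^\varepsilon=(v_1^\varepsilon,v_2^\varepsilon,v_3^\varepsilon)$ on $\mathbb{R}$ by $$v_1^\varepsilon(r)=\frac{(\alpha+\beta)\sin\varepsilon^2\cos(\varepsilon^2+\mu r\sin\varepsilon^2)-\sin(\mu r\sin\varepsilon^2)\big(\exp(2\mu r\cos\varepsilon^2)-\frac\beta2\big)}{\sqrt{(\exp(2\mu r\cos\varepsilon^2)+\alpha+\frac\beta2)^2-\alpha(\alpha+\beta)\cos^2(\varepsilon^2)}},$$ $$v_2^\varepsilon(r)=\frac{(\alpha+\beta)\sin\varepsilon^2\sin(\varepsilon^2+\mu r\sin\varepsilon^2)+\cos(\mu r\sin\varepsilon^2)\big(\exp(2\mu r\cos\varepsilon^2)-\frac\beta2\big)}{\sqrt{(\exp(2\mu r\cos\varepsilon^2)+\alpha+\frac\beta2)^2-\alpha(\alpha+\beta)\cos^2(\varepsilon^2)}},$$ $$v_3^\varepsilon(r)=\frac{\sqrt{2(\alpha+\beta)}\,\cos(\varepsilon^2)\exp(\mu r\cos\varepsilon^2)}{\sqrt{(\exp(2\mu r\cos\varepsilon^2)+\alpha+\frac\beta2)^2-\alpha(\alpha+\beta)\cos^2(\varepsilon^2)}}.$$ Then for all sufficiently small $\varepsilon>0$, $v=v^\varepsilon$ belongs to $C^2(\mathbb{R};\mathbb{R}^3)$, takes values in the unit sphere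 $S^2\subset\mathbb{R}^3$, and satisfies on $\mathbb{R}$ the ordinary differential equations $$v_2v_1''-v_1v_2''=0,\qquad v_3''+|v'|^2v_3-\frac{\alpha+\beta-2\alpha v_3^2}{\varepsilon^2}v_3(1-v_3^2)=0.$$ Further: (i) $\lim_{\varepsilon\to0}\{r\in\mathbb{R}: (v_3^\varepsilon)'(r)=0\}=\{0\}$; (ii) $|v_3^\varepsilon(r)|\ne1$ for all $r\in\mathbb{R}$; (iii) $v_2^\varepsilon(v_1^\varepsilon)'-v_1^\varepsilon(v_2^\varepsilon)'=-\mu\sin\varepsilon^2\neq0$ for all $r\in\mathbb{R}$; (iv) $v_2^\varepsilon(v_1^\varepsilon)''-v_1^\varepsilon(v_2^\varepsilon)''=0$ for all $r\in\mathbb{R}$; (v) pointwise in $r$, $$\lim_{\varepsilon\to0^+}v^\varepsilon(r)=\begin{cases}(0,1,0),&r>0,\\ \Big(0,\frac{2-\beta}{\sqrt{8\alpha+(2+\beta)^2}},\frac{2\sqrt2\sqrt{\alpha+\beta}}{\sqrt{8\alpha+(2+\beta)^2}}\Big),&r=0,\\ (0,-1,0),&r<0.\end{cases}$$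
   Context: The limit of sets in (i) means that for small $\varepsilon$ the set of zeros of $(v_3^\varepsilon)'$ is nonempty and that it converges to $\{0\}$ (in Hausdorff distance) as $\varepsilon\to0$. Primes denote derivatives with respect to $r$. *)

theory Defs
  imports "HOL-Analysis.Analysis"
begin

definition mu :: "real \<Rightarrow> real \<Rightarrow> real \<Rightarrow> real" where
  "mu \<alpha> \<beta> \<epsilon> = sqrt (\<alpha> + \<beta>) / \<epsilon>"

definition vden :: "real \<Rightarrow> real \<Rightarrow> real \<Rightarrow> real \<Rightarrow> real" where
  "vden \<alpha> \<beta> \<epsilon> r =
     sqrt ((exp (2 * mu \<alpha> \<beta> \<epsilon> * r * cos (\<epsilon>\<^sup>2)) + \<alpha> + \<beta> / 2)\<^sup>2
           - \<alpha> * (\<alpha> + \<beta>) * (cos (\<epsilon>\<^sup>2))\<^sup>2)"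

definition v1 :: "real \<Rightarrow> real \<Rightarrow> real \<Rightarrow> real \<Rightarrow> real" where
  "v1 \<alpha> \<beta> \<epsilon> r =
     ((\<alpha> + \<beta>) * sin (\<epsilon>\<^sup>2) * cos (\<epsilon>\<^sup>2 + mu \<alpha> \<beta> \<epsilon> * r * sin (\<epsilon>\<^sup>2))
      - sin (mu \<alpha> \<beta> \<epsilon> * r * sin (\<epsilon>\<^sup>2)) * (exp (2 * mu \<alpha> \<beta> \<epsilon> * r * cos (\<epsilon>\<^sup>2)) - \<beta> / 2))
     / vden \<alpha> \<beta> \<epsilon> r"

definition v2 :: "real \<Rightarrow> real \<Rightarrow> real \<Rightarrow> real \<Rightarrow> real" where
  "v2 \<alpha> \<beta> \<epsilon> r =
     ((\<alpha> + \<beta>) * sin (\<epsilon>\<^sup>2) * sin (\<epsilon>\<^sup>2 + mu \<alpha> \<beta> \<epsilon> * r * sin (\<epsilon>\<^sup>2))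
      + cos (mu \<alpha> \<beta> \<epsilon> * r * sin (\<epsilon>\<^sup>2)) * (exp (2 * mu \<alpha> \<beta> \<epsilon> * r * cos (\<epsilon>\<^sup>2)) - \<beta> / 2))
     / vden \<alpha> \<beta> \<epsilon> r"

definition v3 :: "real \<Rightarrow> real \<Rightarrow> real \<Rightarrow> real \<Rightarrow> real" where
  "v3 \<alpha> \<beta> \<epsilon> r =
     (sqrt (2 * (\<alpha> + \<beta>)) * cos (\<epsilon>\<^sup>2) * exp (mu \<alpha> \<beta> \<epsilon> * r * cos (\<epsilon>\<^sup>2)))
     / vden \<alpha> \<beta> \<epsilon> r"

definition vcurve :: "real \<Rightarrow> real \<Rightarrow> real \<Rightarrow> real \<Rightarrow> real ^ 3" where
  "vcurve \<alpha> \<beta> \<epsilon> r = vector [v1 \<alpha> \<beta> \<epsilon> r, v2 \<alpha> \<beta> \<epsilon> r, v3 \<alpha> \<beta> \<epsilon> r]"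

definition C2_on_reals :: "(real \<Rightarrow> 'a::real_normed_vector) \<Rightarrow> bool" where
  "C2_on_reals f \<longleftrightarrow>
     (\<exists>f'. (\<forall>x. (f has_vector_derivative f' x) (at x)) \<and> f' C1_differentiable_on UNIV)"

text \<open>The Hausdorff distance takes values in \<open>[0, \<infinity>]\<close>: it may be infinite for unbounded sets,
  and it is infinite if exactly one of the two sets is empty.\<close>

definition hausdorff_dist :: "'a::metric_space set \<Rightarrow> 'a set \<Rightarrow> ennreal" where
  "hausdorff_dist A B =
     max (SUP a\<in>A. INF b\<in>B. ennreal (dist a b)) (SUP b\<in>B. INF a\<in>A. ennreal (dist a b))"

end

theory Submission
  imports Defs "HOL-Real_Asymp.Real_Asymp"
begin

text \<open>
  Put \<open>x = v\<^sub>3\<^sup>2\<close>, \<open>h = \<alpha> / (\<alpha> + \<beta>)\<close>, \<open>m = \<mu>\<close>, \<open>s = sin \<epsilon>\<^sup>2\<close>, \<open>c = cos \<epsilon>\<^sup>2\<close>. The whole proof rests on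
  rewriting the explicit curve as a solution of a first-order system, so that the second derivatives
  come out as polynomials in \<open>x\<close> times the components and no long differentiation is needed.

  Up to the common denominator \<open>sqrt D\<close>, the pair \<open>(v\<^sub>1, v\<^sub>2)\<close> is the vector \<open>(Q, P)\<close> rotated by the
  angle \<open>m r s\<close>, where \<open>Q\<close> is constant and \<open>P\<close> is an affine function of \<open>E = exp (2 m r c)\<close>. Since
  \<open>D = P\<^sup>2 + Q\<^sup>2 + 2 (\<alpha> + \<beta>) c\<^sup>2 E\<close> (\<open>D_split\<close>), the curve is defined everywhere, lies on the sphere, and
  \<open>1 - x = (P\<^sup>2 + Q\<^sup>2) / D\<close> is positive because \<open>Q > 0\<close>: the third component never has modulus 1.

  Writing \<open>v\<^sub>3' = q v\<^sub>3\<close>, the planar part turns with angular speed \<open>b = m s / (1 - x)\<close>, which is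
  conservation of angular momentum, and its length \<open>sqrt (1 - x)\<close> has logarithmic derivative
  \<open>a = - x q / (1 - x)\<close>; hence
  \<open>v\<^sub>1' = a v\<^sub>1 - b v\<^sub>2\<close> and \<open>v\<^sub>2' = b v\<^sub>1 + a v\<^sub>2\<close>. The wall profile has the first integral
  \<open>q\<^sup>2 = m\<^sup>2 ((1 - x) (1 - h x) - s\<^sup>2)\<close> (\<open>q_squared\<close>), and \<open>q'\<close> is again a polynomial in \<open>x\<close> (\<open>q_deriv\<close>).
  Differentiating the system once more and eliminating \<open>q\<^sup>2\<close> gives
  \<open>(v\<^sub>1, v\<^sub>2)'' = - m\<^sup>2 (s\<^sup>2 + 2 x - 3 h x\<^sup>2) (v\<^sub>1, v\<^sub>2)\<close> and
  \<open>v\<^sub>3'' = m\<^sup>2 (c\<^sup>2 - 2 (1 + h) x + 3 h x\<^sup>2) v\<^sub>3\<close>. The planar acceleration is central, which is the first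
  differential equation; continuity of the second derivatives is obvious; and the second equation
  follows from \<open>|v'|\<^sup>2 = m\<^sup>2 (x (1 - h x) + s\<^sup>2)\<close> and \<open>m\<^sup>2 = (\<alpha> + \<beta>) / \<epsilon>\<^sup>2\<close>.

  The critical points of \<open>v\<^sub>3\<close> are the zeros of \<open>q\<close>, that is of \<open>C - E\<^sup>2\<close> with \<open>C\<close> close to \<open>\<beta>\<^sup>2 / 4 > 0\<close>;
  so there is exactly one, \<open>ln C / (4 m c)\<close>, and it tends to 0 because \<open>m\<close> is of order \<open>1 / \<epsilon>\<close>. For the
  pointwise limits, numerators and denominators are homogeneous in \<open>(1, E)\<close>, so only the
  limit of the ratio \<open>1 : E\<close> matters: it is \<open>0 : 1\<close>, \<open>1 : 1\<close> or \<open>1 : 0\<close> according to the sign of \<open>r\<close>.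
\<close>

section \<open>The components in rotating coordinates\<close>

text \<open>Stated with the logarithmic derivative \<open>d\<close> of the denominator, so that the derivative of each
  component is visibly a multiple of the same denominator.\<close>
lemma DERIV_quotient_log:
  assumes "(f has_real_derivative f') (at r)" "(g has_real_derivative d * g r) (at r)" "g r \<noteq> 0"
  shows "((\<lambda>r. f r / g r) has_real_derivative (f' - d * f r) / g r) (at r)"
  using DERIV_divide[OF assms] assms(3) by (simp add: diff_divide_distrib mult.commute)

text \<open>The smallness of \<open>\<epsilon>\<close> enters all algebraic identities only through these signs.\<close>
locale wall_parameters =
  fixes \<alpha> \<beta> \<epsilon> :: real
  assumes sum_pos: "\<alpha> + \<beta> > 0"
    and eps_pos: "\<epsilon> > 0"
    and sin_pos: "sin (\<epsilon>\<^sup>2) > 0"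
    and cos_pos: "cos (\<epsilon>\<^sup>2) > 0"
begin

definition "m = mu \<alpha> \<beta> \<epsilon>"
definition "s = sin (\<epsilon>\<^sup>2)"
definition "c = cos (\<epsilon>\<^sup>2)"
definition "h = \<alpha> / (\<alpha> + \<beta>)"

text \<open>The square of the common denominator is \<open>D\<close>, and \<open>C\<close> is its value at \<open>E = 0\<close>. The planar
  numerators \<open>(N1, N2)\<close> arise from \<open>(Q, P)\<close> by rotation through \<open>\<theta>\<close>; \<open>S\<close> is their squared length.\<close>
definition "E r = exp (2 * m * r * c)"
definition "\<theta> r = m * r * s"
definition "C = \<beta>\<^sup>2 / 4 + \<alpha> * (\<alpha> + \<beta>) * s\<^sup>2"
definition "D r = (E r)\<^sup>2 + (2 * \<alpha> + \<beta>) * E r + C"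
definition "P r = E r - \<beta> / 2 + (\<alpha> + \<beta>) * s\<^sup>2"
definition "Q = (\<alpha> + \<beta>) * s * c"
definition "S r = (P r)\<^sup>2 + Q\<^sup>2"
definition "N1 r = Q * cos (\<theta> r) - P r * sin (\<theta> r)"
definition "N2 r = P r * cos (\<theta> r) + Q * sin (\<theta> r)"

text \<open>The logarithmic derivative of \<open>v\<^sub>3\<close> is \<open>q\<close>, that of the planar length \<open>sqrt (1 - x)\<close> is \<open>a\<close>, and
  \<open>b\<close> is the angular velocity of the planar part.\<close>
definition "x r = (v3 \<alpha> \<beta> \<epsilon> r)\<^sup>2"
definition "q r = m * c * (C - (E r)\<^sup>2) / D r"
definition "a r = - x r * q r / (1 - x r)"
definition "b r = m * s / (1 - x r)"

lemma s_pos: "s > 0" and c_pos: "c > 0" and sc: "c\<^sup>2 = 1 - s\<^sup>2"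
  using sin_pos cos_pos by (auto simp: s_def c_def cos_squared_eq)

lemma m_pos: "m > 0"
  using sum_pos eps_pos by (simp add: m_def mu_def)

lemma m_sq: "m\<^sup>2 = (\<alpha> + \<beta>) / \<epsilon>\<^sup>2"
  using sum_pos by (simp add: m_def mu_def power_divide)

lemma E_pos: "E r > 0"
  by (simp add: E_def)

text \<open>This identity contains both the positivity of the radicand and \<open>|v| = 1\<close>, since the last summand
  is the squared numerator of \<open>v\<^sub>3\<close>.\<close>
lemma D_split: "D r = S r + 2 * (\<alpha> + \<beta>) * c\<^sup>2 * E r"
  unfolding D_def S_def P_def Q_def C_def power_mult_distrib sc
  by (simp add: power2_eq_square algebra_simps)

lemma Q_pos: "Q > 0"
  using sum_pos s_pos c_pos by (simp add: Q_def)

lemma S_pos: "S r > 0"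
  using Q_pos by (simp add: S_def add_nonneg_pos)

lemma D_pos: "D r > 0"
  unfolding D_split using S_pos[of r] sum_pos c_pos E_pos[of r]
  by (simp add: add_pos_pos)

lemma vden_eq: "vden \<alpha> \<beta> \<epsilon> r = sqrt (D r)"
  unfolding vden_def m_def[symmetric] c_def[symmetric] E_def[symmetric]
  unfolding D_def C_def sc by (simp add: power2_eq_square algebra_simps)

lemma v1_eq: "v1 \<alpha> \<beta> \<epsilon> r = N1 r / sqrt (D r)"
proof -
  have "v1 \<alpha> \<beta> \<epsilon> r = ((\<alpha> + \<beta>) * s * (c * cos (\<theta> r) - s * sin (\<theta> r))
      - sin (\<theta> r) * (E r - \<beta> / 2)) / sqrt (D r)"
    unfolding v1_def vden_eq E_def \<theta>_def m_def s_def c_def by (simp add: cos_add)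
  then show ?thesis
    by (simp add: N1_def P_def Q_def power2_eq_square algebra_simps)
qed

lemma v2_eq: "v2 \<alpha> \<beta> \<epsilon> r = N2 r / sqrt (D r)"
proof -
  have "v2 \<alpha> \<beta> \<epsilon> r = ((\<alpha> + \<beta>) * s * (s * cos (\<theta> r) + c * sin (\<theta> r))
      + cos (\<theta> r) * (E r - \<beta> / 2)) / sqrt (D r)"
    unfolding v2_def vden_eq E_def \<theta>_def m_def s_def c_def by (simp add: sin_add)
  then show ?thesis
    by (simp add: N2_def P_def Q_def power2_eq_square algebra_simps)
qed

lemma v3_eq: "v3 \<alpha> \<beta> \<epsilon> r = sqrt (2 * (\<alpha> + \<beta>)) * c * exp (m * r * c) / sqrt (D r)"
  by (simp add: v3_def vden_eq m_def c_def)

lemma v3_pos: "v3 \<alpha> \<beta> \<epsilon> r > 0"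
  unfolding v3_eq using sum_pos c_pos D_pos by simp

lemma x_eq: "x r = 2 * (\<alpha> + \<beta>) * c\<^sup>2 * E r / D r"
proof -
  have "E r = (exp (m * r * c))\<^sup>2"
    by (simp add: E_def power2_eq_square flip: exp_add)
  then show ?thesis
    using sum_pos D_pos[of r] by (simp add: x_def v3_eq power_divide power_mult_distrib)
qed

lemma one_minus_x: "1 - x r = S r / D r"
  using D_pos[of r] by (simp add: x_eq field_simps) (simp add: D_split algebra_simps)

lemma x_less_1: "x r < 1"
  using one_minus_x[of r] S_pos[of r] D_pos[of r]
  by (smt (verit) divide_pos_pos)

lemma planar_norm: "(v1 \<alpha> \<beta> \<epsilon> r)\<^sup>2 + (v2 \<alpha> \<beta> \<epsilon> r)\<^sup>2 = 1 - x r"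
proof -
  have "(N1 r)\<^sup>2 + (N2 r)\<^sup>2 = S r * ((sin (\<theta> r))\<^sup>2 + (cos (\<theta> r))\<^sup>2)"
    unfolding S_def N1_def N2_def by algebra
  then show ?thesis
    using D_pos[of r] by (simp add: v1_eq v2_eq one_minus_x power_divide flip: add_divide_distrib)
qed

lemma E_deriv: "(E has_real_derivative 2 * m * c * E r) (at r)"
  unfolding E_def by (auto intro!: derivative_eq_intros simp: algebra_simps)

lemma D_deriv: "(D has_real_derivative 2 * m * c * E r * (2 * E r + (2 * \<alpha> + \<beta>))) (at r)"
  unfolding D_def[abs_def]
  by (auto intro!: derivative_eq_intros E_deriv simp: algebra_simps power2_eq_square)

lemma sqrt_D_deriv:
  "((\<lambda>r. sqrt (D r)) has_real_derivative
     m * c * E r * (2 * E r + (2 * \<alpha> + \<beta>)) / D r * sqrt (D r)) (at r)"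
  using D_pos[of r]
  by (auto intro!: derivative_eq_intros D_deriv simp: field_simps)

section \<open>The first-order system\<close>

text \<open>The rotation contributes \<open>m s (- N2, N1)\<close>; the rest is the derivative of \<open>P\<close>, turned by \<open>\<theta>\<close>.\<close>
lemma N1_deriv: "(N1 has_real_derivative - m * s * N2 r - 2 * m * c * E r * sin (\<theta> r)) (at r)"
  and N2_deriv: "(N2 has_real_derivative m * s * N1 r + 2 * m * c * E r * cos (\<theta> r)) (at r)"
  unfolding N1_def[abs_def] N2_def[abs_def] P_def[abs_def] \<theta>_def
  by (auto intro!: derivative_eq_intros E_deriv simp: algebra_simps)

text \<open>Undoing the rotation expresses the trigonometric terms in \<open>N1_deriv\<close> and \<open>N2_deriv\<close> through the
  numerators themselves, so that the system closes.\<close>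
lemma sin_theta: "sin (\<theta> r) = (Q * N2 r - P r * N1 r) / S r"
  and cos_theta: "cos (\<theta> r) = (Q * N1 r + P r * N2 r) / S r"
proof -
  have nz: "S r \<noteq> 0" using S_pos[of r] by simp
  show "sin (\<theta> r) = (Q * N2 r - P r * N1 r) / S r"
    "cos (\<theta> r) = (Q * N1 r + P r * N2 r) / S r"
    unfolding nonzero_eq_divide_eq[OF nz] unfolding S_def N1_def N2_def
    by (simp_all add: algebra_simps power2_eq_square)
qed

text \<open>The coefficient that the quotient rule produces: half the logarithmic derivative of
  \<open>S\<close> minus that of \<open>sqrt D\<close>.\<close>
lemma a_eq: "a r = 2 * m * c * E r * P r / S r
    - m * c * E r * (2 * E r + (2 * \<alpha> + \<beta>)) / D r"
proof -
  have id: "2 * D r * P r - (2 * E r + (2 * \<alpha> + \<beta>)) * S r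
      + 2 * (\<alpha> + \<beta>) * c\<^sup>2 * (C - (E r)\<^sup>2) = 0"
    unfolding D_def S_def P_def Q_def C_def power_mult_distrib sc
    by (simp add: power2_eq_square algebra_simps)
  have "a r = - (2 * (\<alpha> + \<beta>) * c\<^sup>2 * (C - (E r)\<^sup>2)) * (m * c * E r) / (D r * S r)"
    unfolding a_def one_minus_x using D_pos[of r] S_pos[of r]
    by (simp add: x_eq q_def)
  also have "\<dots> = (2 * D r * P r - (2 * E r + (2 * \<alpha> + \<beta>)) * S r) * (m * c * E r) / (D r * S r)"
    using id by (metis (no_types, lifting) add_eq_0_iff2)
  finally show ?thesis
    using D_pos[of r] S_pos[of r] by (simp add: field_simps)
qed

text \<open>The speed \<open>m s\<close> of the rotation plus the speed with which \<open>(Q, P)\<close> turns by itself as \<open>E\<close> grows.\<close>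
lemma b_eq: "b r = m * s + 2 * m * c * E r * Q / S r"
proof -
  have "b r = m * s * D r / S r"
    by (simp add: b_def one_minus_x)
  also have "\<dots> = m * s * (S r + 2 * (\<alpha> + \<beta>) * c\<^sup>2 * E r) / S r"
    by (simp only: D_split)
  finally show ?thesis
    using S_pos[of r] by (simp add: Q_def field_simps power2_eq_square)
qed

lemma v1_deriv:
  "(v1 \<alpha> \<beta> \<epsilon> has_real_derivative a r * v1 \<alpha> \<beta> \<epsilon> r - b r * v2 \<alpha> \<beta> \<epsilon> r) (at r)"
proof -
  have "((\<lambda>r. N1 r / sqrt (D r)) has_real_derivative
      (- m * s * N2 r - 2 * m * c * E r * sin (\<theta> r)
       - m * c * E r * (2 * E r + (2 * \<alpha> + \<beta>)) / D r * N1 r) / sqrt (D r)) (at r)"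
    using D_pos[of r] by (intro DERIV_quotient_log N1_deriv sqrt_D_deriv) simp
  also have "(- m * s * N2 r - 2 * m * c * E r * sin (\<theta> r)
       - m * c * E r * (2 * E r + (2 * \<alpha> + \<beta>)) / D r * N1 r) / sqrt (D r)
     = a r * v1 \<alpha> \<beta> \<epsilon> r - b r * v2 \<alpha> \<beta> \<epsilon> r"
    unfolding sin_theta v1_eq v2_eq a_eq b_eq
    by (simp add: algebra_simps add_divide_distrib diff_divide_distrib)
  finally show ?thesis
    by (simp add: v1_eq[abs_def])
qed

lemma v2_deriv:
  "(v2 \<alpha> \<beta> \<epsilon> has_real_derivative b r * v1 \<alpha> \<beta> \<epsilon> r + a r * v2 \<alpha> \<beta> \<epsilon> r) (at r)"
proof -
  have "((\<lambda>r. N2 r / sqrt (D r)) has_real_derivative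
      (m * s * N1 r + 2 * m * c * E r * cos (\<theta> r)
       - m * c * E r * (2 * E r + (2 * \<alpha> + \<beta>)) / D r * N2 r) / sqrt (D r)) (at r)"
    using D_pos[of r] by (intro DERIV_quotient_log N2_deriv sqrt_D_deriv) simp
  also have "(m * s * N1 r + 2 * m * c * E r * cos (\<theta> r)
       - m * c * E r * (2 * E r + (2 * \<alpha> + \<beta>)) / D r * N2 r) / sqrt (D r)
     = b r * v1 \<alpha> \<beta> \<epsilon> r + a r * v2 \<alpha> \<beta> \<epsilon> r"
    unfolding cos_theta v1_eq v2_eq a_eq b_eq
    by (simp add: algebra_simps add_divide_distrib diff_divide_distrib)
  finally show ?thesis
    by (simp add: v2_eq[abs_def])
qed

lemma v3_deriv: "(v3 \<alpha> \<beta> \<epsilon> has_real_derivative q r * v3 \<alpha> \<beta> \<epsilon> r) (at r)"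
proof -
  let ?n = "\<lambda>r. sqrt (2 * (\<alpha> + \<beta>)) * c * exp (m * r * c)"
  have n: "(?n has_real_derivative m * c * ?n r) (at r)"
    by (auto intro!: derivative_eq_intros)
  have "((\<lambda>r. ?n r / sqrt (D r)) has_real_derivative
      (m * c - m * c * E r * (2 * E r + (2 * \<alpha> + \<beta>)) / D r) * (?n r / sqrt (D r))) (at r)"
    using DERIV_quotient_log[OF n sqrt_D_deriv] D_pos[of r]
    by (simp add: left_diff_distrib diff_divide_distrib)
  also have "m * c - m * c * E r * (2 * E r + (2 * \<alpha> + \<beta>)) / D r = q r"
    using D_pos[of r] by (simp add: q_def field_simps) (simp add: D_def algebra_simps power2_eq_square)
  finally show ?thesis
    by (simp add: v3_eq[abs_def])
qed

section \<open>The first integral and the second derivatives\<close>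

text \<open>The discriminant of \<open>D\<close> as a quadratic polynomial in \<open>E\<close>. It is what turns
  \<open>(C - E\<^sup>2)\<^sup>2\<close> into a quadratic form in \<open>D\<close> and \<open>E\<close>, hence \<open>q\<^sup>2\<close> into a polynomial in \<open>E / D\<close>,
  which is a multiple of \<open>x\<close>.\<close>
lemma discriminant: "(2 * \<alpha> + \<beta>)\<^sup>2 = 4 * C + 4 * \<alpha> * (\<alpha> + \<beta>) * c\<^sup>2"
  unfolding C_def sc by (simp add: power2_eq_square algebra_simps)

lemma h_sum: "(\<alpha> + \<beta>) * h = \<alpha>" "(\<alpha> + \<beta>) * (1 + h) = 2 * \<alpha> + \<beta>"
  using sum_pos by (simp_all add: h_def field_simps)

text \<open>Conservation of energy for the wall profile: multiplied by \<open>x\<close>, the left-hand side is \<open>(v\<^sub>3')\<^sup>2\<close>.\<close>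
lemma q_squared: "(q r)\<^sup>2 = m\<^sup>2 * ((1 - x r) * (1 - h * x r) - s\<^sup>2)"
proof -
  have "(C - (E r)\<^sup>2)\<^sup>2 = (D r)\<^sup>2 - 2 * (2 * \<alpha> + \<beta>) * E r * D r
      + 4 * \<alpha> * (\<alpha> + \<beta>) * c\<^sup>2 * (E r)\<^sup>2"
    using discriminant unfolding D_def by algebra
  then have "(q r)\<^sup>2 = m\<^sup>2 * c\<^sup>2 * ((D r)\<^sup>2 - 2 * (2 * \<alpha> + \<beta>) * E r * D r
      + 4 * \<alpha> * (\<alpha> + \<beta>) * c\<^sup>2 * (E r)\<^sup>2) / (D r)\<^sup>2"
    by (simp add: q_def power_divide power_mult_distrib)
  also have "\<dots> = m\<^sup>2 * (c\<^sup>2 - (2 * \<alpha> + \<beta>) * (2 * c\<^sup>2 * E r / D r)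
      + (\<alpha> * (\<alpha> + \<beta>)) * (2 * c\<^sup>2 * E r / D r)\<^sup>2)"
    using D_pos[of r] by (simp add: field_simps power2_eq_square)
  also have "\<dots> = m\<^sup>2 * (c\<^sup>2 - (1 + h) * x r + h * (x r)\<^sup>2)"
  proof -
    have "x r = (\<alpha> + \<beta>) * (2 * c\<^sup>2 * E r / D r)" by (simp add: x_eq)
    then have "(1 + h) * x r = (2 * \<alpha> + \<beta>) * (2 * c\<^sup>2 * E r / D r)"
      "h * (x r)\<^sup>2 = (\<alpha> * (\<alpha> + \<beta>)) * (2 * c\<^sup>2 * E r / D r)\<^sup>2"
      using h_sum by algebra+
    then show ?thesis by simp
  qed
  finally show ?thesis
    unfolding sc by (simp add: algebra_simps power2_eq_square)
qed

text \<open>Differentiating \<open>q_squared\<close> would give the same right-hand side only after division by \<open>q\<close>, which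
  vanishes at one point; therefore the quotient defining \<open>q\<close> is differentiated directly.\<close>
lemma q_deriv: "(q has_real_derivative m\<^sup>2 * (2 * h * (x r)\<^sup>2 - (1 + h) * x r)) (at r)"
proof -
  let ?k = "2 * \<alpha> + \<beta>" and ?y = "2 * c\<^sup>2 * E r / D r"
  have "((\<lambda>r. m * c * (C - (E r)\<^sup>2) / D r) has_real_derivative
     m\<^sup>2 * c\<^sup>2 * (- 4 * (E r)\<^sup>2 * D r - (C - (E r)\<^sup>2) * (2 * E r * (2 * E r + ?k))) / (D r)\<^sup>2) (at r)"
    using D_pos[of r]
    by (auto intro!: derivative_eq_intros E_deriv D_deriv simp: field_simps power2_eq_square)
  also have "- 4 * (E r)\<^sup>2 * D r - (C - (E r)\<^sup>2) * (2 * E r * (2 * E r + ?k))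
     = 8 * \<alpha> * (\<alpha> + \<beta>) * c\<^sup>2 * (E r)\<^sup>2 - 2 * ?k * E r * D r"
    using discriminant unfolding D_def by algebra
  also have "m\<^sup>2 * c\<^sup>2 * \<dots> / (D r)\<^sup>2 = m\<^sup>2 * (2 * (\<alpha> * (\<alpha> + \<beta>)) * ?y\<^sup>2 - ?k * ?y)"
    using D_pos[of r] by (simp add: field_simps power2_eq_square)
  also have "2 * (\<alpha> * (\<alpha> + \<beta>)) * ?y\<^sup>2 - ?k * ?y = 2 * h * (x r)\<^sup>2 - (1 + h) * x r"
  proof -
    have "x r = (\<alpha> + \<beta>) * ?y" by (simp add: x_eq)
    then show ?thesis using h_sum by algebra
  qed
  finally show ?thesis
    by (simp add: q_def[abs_def])
qed

lemma x_deriv: "(x has_real_derivative 2 * q r * x r) (at r)"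
  unfolding x_def[abs_def]
  by (auto intro!: derivative_eq_intros v3_deriv simp: power2_eq_square)

text \<open>The product \<open>b (1 - x)\<close> is constant and \<open>1 - x\<close> has logarithmic derivative \<open>2 a\<close>. The cross term
  \<open>b' + 2 a b\<close> of the planar acceleration therefore vanishes.\<close>
lemma b_deriv: "(b has_real_derivative - 2 * a r * b r) (at r)"
  unfolding b_def[abs_def] a_def using x_less_1[of r]
  by (auto intro!: derivative_eq_intros x_deriv simp: field_simps power2_eq_square)

text \<open>The radial coefficient \<open>a' + a\<^sup>2 - b\<^sup>2\<close> of the planar acceleration has the denominator
  \<open>(1 - x)\<^sup>2\<close>, which cancels once \<open>q\<^sup>2\<close> is eliminated by the first integral.\<close>
lemma a_deriv:
  "(a has_real_derivative (b r)\<^sup>2 - (a r)\<^sup>2 - m\<^sup>2 * (s\<^sup>2 + 2 * x r - 3 * h * (x r)\<^sup>2)) (at r)"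
proof -
  let ?x = "x r" and ?q' = "m\<^sup>2 * (2 * h * (x r)\<^sup>2 - (1 + h) * x r)"
  have nz: "1 - ?x \<noteq> 0" using x_less_1[of r] by simp
  have d: "(a has_real_derivative - (2 * ?x * (q r)\<^sup>2 + ?x * (1 - ?x) * ?q') / (1 - ?x)\<^sup>2) (at r)"
  proof -
    have "((\<lambda>r. - x r * q r) has_real_derivative - (2 * ?x * (q r)\<^sup>2 + ?x * ?q')) (at r)"
      by (rule derivative_eq_intros x_deriv q_deriv refl)+ (simp add: power2_eq_square)
    moreover have "((\<lambda>r. 1 - x r) has_real_derivative - (2 * q r * ?x)) (at r)"
      by (rule derivative_eq_intros x_deriv refl)+ simp
    ultimately have "(a has_real_derivative
        (- (2 * ?x * (q r)\<^sup>2 + ?x * ?q') * (1 - ?x) - - ?x * q r * - (2 * q r * ?x))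
        / ((1 - ?x) * (1 - ?x))) (at r)"
      unfolding a_def[abs_def] using nz by (rule DERIV_divide)
    moreover have "- (2 * ?x * (q r)\<^sup>2 + ?x * ?q') * (1 - ?x) - - ?x * q r * - (2 * q r * ?x)
        = - (2 * ?x * (q r)\<^sup>2 + ?x * (1 - ?x) * ?q')"
      by algebra
    ultimately show ?thesis
      by (simp only: power2_eq_square)
  qed
  have "(m * s)\<^sup>2 - (?x * q r)\<^sup>2 + 2 * ?x * (q r)\<^sup>2 + ?x * (1 - ?x) * ?q'
     = m\<^sup>2 * (s\<^sup>2 + 2 * ?x - 3 * h * ?x\<^sup>2) * (1 - ?x)\<^sup>2"
    using q_squared[of r] by algebra
  then have "- (2 * ?x * (q r)\<^sup>2 + ?x * (1 - ?x) * ?q')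
    = (m * s)\<^sup>2 - (?x * q r)\<^sup>2 - m\<^sup>2 * (s\<^sup>2 + 2 * ?x - 3 * h * ?x\<^sup>2) * (1 - ?x)\<^sup>2"
    by simp
  then have "- (2 * ?x * (q r)\<^sup>2 + ?x * (1 - ?x) * ?q') / (1 - ?x)\<^sup>2
    = (b r)\<^sup>2 - (a r)\<^sup>2 - m\<^sup>2 * (s\<^sup>2 + 2 * ?x - 3 * h * ?x\<^sup>2)"
    using nz by (simp add: a_def b_def power_divide diff_divide_distrib)
  with d show ?thesis by simp
qed

text \<open>The factors in \<open>v\<^sub>1'' = g v\<^sub>1\<close>, \<open>v\<^sub>2'' = g v\<^sub>2\<close> and \<open>v\<^sub>3'' = f v\<^sub>3\<close>.\<close>
abbreviation "g r \<equiv> - m\<^sup>2 * (s\<^sup>2 + 2 * x r - 3 * h * (x r)\<^sup>2)"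
abbreviation "f r \<equiv> m\<^sup>2 * (c\<^sup>2 - 2 * (1 + h) * x r + 3 * h * (x r)\<^sup>2)"

lemma v1_deriv2:
  "((\<lambda>r. a r * v1 \<alpha> \<beta> \<epsilon> r - b r * v2 \<alpha> \<beta> \<epsilon> r) has_real_derivative g r * v1 \<alpha> \<beta> \<epsilon> r) (at r)"
  by (auto intro!: derivative_eq_intros a_deriv b_deriv v1_deriv v2_deriv
      simp: algebra_simps power2_eq_square)

lemma v2_deriv2:
  "((\<lambda>r. b r * v1 \<alpha> \<beta> \<epsilon> r + a r * v2 \<alpha> \<beta> \<epsilon> r) has_real_derivative g r * v2 \<alpha> \<beta> \<epsilon> r) (at r)"
  by (auto intro!: derivative_eq_intros a_deriv b_deriv v1_deriv v2_deriv
      simp: algebra_simps power2_eq_square)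

lemma v3_deriv2:
  "((\<lambda>r. q r * v3 \<alpha> \<beta> \<epsilon> r) has_real_derivative f r * v3 \<alpha> \<beta> \<epsilon> r) (at r)"
proof -
  have "m\<^sup>2 * (2 * h * (x r)\<^sup>2 - (1 + h) * x r) + (q r)\<^sup>2 = f r"
    unfolding q_squared sc by (simp add: algebra_simps power2_eq_square)
  then have "f r * v3 \<alpha> \<beta> \<epsilon> r
      = m\<^sup>2 * (2 * h * (x r)\<^sup>2 - (1 + h) * x r) * v3 \<alpha> \<beta> \<epsilon> r + q r * v3 \<alpha> \<beta> \<epsilon> r * q r"
    by algebra
  then show ?thesis
    using DERIV_mult[OF q_deriv v3_deriv] by simp
qed

lemma deriv_eq:
  "deriv (v1 \<alpha> \<beta> \<epsilon>) = (\<lambda>r. a r * v1 \<alpha> \<beta> \<epsilon> r - b r * v2 \<alpha> \<beta> \<epsilon> r)"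
  "deriv (v2 \<alpha> \<beta> \<epsilon>) = (\<lambda>r. b r * v1 \<alpha> \<beta> \<epsilon> r + a r * v2 \<alpha> \<beta> \<epsilon> r)"
  "deriv (v3 \<alpha> \<beta> \<epsilon>) = (\<lambda>r. q r * v3 \<alpha> \<beta> \<epsilon> r)"
  by (intro ext DERIV_imp_deriv v1_deriv v2_deriv v3_deriv)+

lemma deriv2_eq:
  "deriv (deriv (v1 \<alpha> \<beta> \<epsilon>)) = (\<lambda>r. g r * v1 \<alpha> \<beta> \<epsilon> r)"
  "deriv (deriv (v2 \<alpha> \<beta> \<epsilon>)) = (\<lambda>r. g r * v2 \<alpha> \<beta> \<epsilon> r)"
  "deriv (deriv (v3 \<alpha> \<beta> \<epsilon>)) = (\<lambda>r. f r * v3 \<alpha> \<beta> \<epsilon> r)"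
  unfolding deriv_eq by (intro ext DERIV_imp_deriv v1_deriv2 v2_deriv2 v3_deriv2)+

end
section \<open>Curves in three-dimensional space, componentwise\<close>

lemma vector_3_axis:
  "(vector [y1, y2, y3] :: real ^ 3) = y1 *\<^sub>R axis 1 1 + y2 *\<^sub>R axis 2 1 + y3 *\<^sub>R axis 3 1"
  by (simp add: vec_eq_iff forall_3 axis_def)

lemma has_vector_derivative_vector_3:
  assumes "(f1 has_real_derivative d1) F" "(f2 has_real_derivative d2) F"
    "(f3 has_real_derivative d3) F"
  shows "((\<lambda>t. vector [f1 t, f2 t, f3 t] :: real ^ 3) has_vector_derivative vector [d1, d2, d3]) F"
  unfolding vector_3_axis
  using assms[unfolded has_real_derivative_iff_has_vector_derivative]
  by (intro has_vector_derivative_add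
      bounded_linear.has_vector_derivative[OF bounded_linear_scaleR_left])

lemma continuous_on_vector_3:
  fixes f1 f2 f3 :: "'a::topological_space \<Rightarrow> real"
  assumes "continuous_on T f1" "continuous_on T f2" "continuous_on T f3"
  shows "continuous_on T (\<lambda>t. vector [f1 t, f2 t, f3 t] :: real ^ 3)"
  unfolding vector_3_axis by (intro continuous_intros assms)

lemma tendsto_vector_3:
  fixes f1 f2 f3 :: "'a \<Rightarrow> real"
  assumes "(f1 \<longlongrightarrow> l1) F" "(f2 \<longlongrightarrow> l2) F" "(f3 \<longlongrightarrow> l3) F"
  shows "((\<lambda>t. vector [f1 t, f2 t, f3 t] :: real ^ 3) \<longlongrightarrow> vector [l1, l2, l3]) F"
  unfolding vector_3_axis by (intro tendsto_intros assms)

lemma norm_vector_3_squared: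
  "(norm (vector [y1, y2, y3] :: real ^ 3))\<^sup>2 = y1\<^sup>2 + y2\<^sup>2 + y3\<^sup>2"
  by (simp add: norm_vec_def L2_set_def sum_3)
section \<open>Properties of the curve for fixed parameters\<close>

context wall_parameters
begin

lemma vcurve_deriv:
  "(vcurve \<alpha> \<beta> \<epsilon> has_vector_derivative
     vector [a r * v1 \<alpha> \<beta> \<epsilon> r - b r * v2 \<alpha> \<beta> \<epsilon> r,
       b r * v1 \<alpha> \<beta> \<epsilon> r + a r * v2 \<alpha> \<beta> \<epsilon> r, q r * v3 \<alpha> \<beta> \<epsilon> r]) (at r)"
  unfolding vcurve_def[abs_def]
  by (intro has_vector_derivative_vector_3 v1_deriv v2_deriv v3_deriv)

lemma C2_vcurve: "C2_on_reals (vcurve \<alpha> \<beta> \<epsilon>)"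
proof -
  let ?d = "\<lambda>r. vector [a r * v1 \<alpha> \<beta> \<epsilon> r - b r * v2 \<alpha> \<beta> \<epsilon> r,
       b r * v1 \<alpha> \<beta> \<epsilon> r + a r * v2 \<alpha> \<beta> \<epsilon> r, q r * v3 \<alpha> \<beta> \<epsilon> r] :: real ^ 3"
  have cont: "continuous_on UNIV (v1 \<alpha> \<beta> \<epsilon>)" "continuous_on UNIV (v2 \<alpha> \<beta> \<epsilon>)"
      "continuous_on UNIV (v3 \<alpha> \<beta> \<epsilon>)"
    by (meson DERIV_isCont continuous_at_imp_continuous_on v1_deriv v2_deriv v3_deriv)+
  have "?d C1_differentiable_on UNIV"
    unfolding C1_differentiable_on_def
  proof (intro exI conjI ballI)
    show "(?d has_vector_derivative
      vector [g r * v1 \<alpha> \<beta> \<epsilon> r, g r * v2 \<alpha> \<beta> \<epsilon> r, f r * v3 \<alpha> \<beta> \<epsilon> r]) (at r)" for r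
      by (intro has_vector_derivative_vector_3 v1_deriv2 v2_deriv2 v3_deriv2)
    show "continuous_on UNIV (\<lambda>r. vector
      [g r * v1 \<alpha> \<beta> \<epsilon> r, g r * v2 \<alpha> \<beta> \<epsilon> r, f r * v3 \<alpha> \<beta> \<epsilon> r] :: real ^ 3)"
      unfolding x_def by (intro continuous_on_vector_3 continuous_intros cont)
  qed
  then show ?thesis
    unfolding C2_on_reals_def by (intro exI[of _ ?d] conjI allI vcurve_deriv)
qed

lemma vcurve_sphere: "vcurve \<alpha> \<beta> \<epsilon> r \<in> sphere 0 1"
proof -
  have "(norm (vcurve \<alpha> \<beta> \<epsilon> r))\<^sup>2 = 1"
    unfolding vcurve_def norm_vector_3_squared using planar_norm[of r] by (simp add: x_def)
  then show ?thesis by (simp add: power2_eq_1_iff) (smt (verit) norm_ge_zero)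
qed

lemma speed_squared:
  "(norm (vector_derivative (vcurve \<alpha> \<beta> \<epsilon>) (at r)))\<^sup>2 = m\<^sup>2 * (x r * (1 - h * x r) + s\<^sup>2)"
proof -
  let ?v1 = "v1 \<alpha> \<beta> \<epsilon> r" and ?v2 = "v2 \<alpha> \<beta> \<epsilon> r"
  have nz: "1 - x r \<noteq> 0" using x_less_1[of r] by simp
  have "(norm (vector_derivative (vcurve \<alpha> \<beta> \<epsilon>) (at r)))\<^sup>2
      = (a r * ?v1 - b r * ?v2)\<^sup>2 + (b r * ?v1 + a r * ?v2)\<^sup>2 + (q r)\<^sup>2 * x r"
    by (simp add: vector_derivative_at[OF vcurve_deriv] norm_vector_3_squared power_mult_distrib x_def)
  also have "\<dots> = ((a r)\<^sup>2 + (b r)\<^sup>2) * (1 - x r) + (q r)\<^sup>2 * x r"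
    unfolding planar_norm[symmetric] by algebra
  also have "\<dots> = ((x r)\<^sup>2 * (q r)\<^sup>2 + m\<^sup>2 * s\<^sup>2) / (1 - x r) + (q r)\<^sup>2 * x r"
    using nz by (simp add: a_def b_def power_divide power_mult_distrib power2_eq_square
        flip: add_divide_distrib)
  also have "\<dots> = (x r * (q r)\<^sup>2 + m\<^sup>2 * s\<^sup>2) / (1 - x r)"
    using nz by (simp add: field_simps power2_eq_square)
  also have "\<dots> = m\<^sup>2 * (x r * (1 - h * x r) + s\<^sup>2)"
    unfolding q_squared using nz by (simp add: divide_simps) algebra
  finally show ?thesis .
qed

lemma v3_equation:
  "deriv (deriv (v3 \<alpha> \<beta> \<epsilon>)) r
     + (norm (vector_derivative (vcurve \<alpha> \<beta> \<epsilon>) (at r)))\<^sup>2 * v3 \<alpha> \<beta> \<epsilon> r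
     - (\<alpha> + \<beta> - 2 * \<alpha> * (v3 \<alpha> \<beta> \<epsilon> r)\<^sup>2) / \<epsilon>\<^sup>2
       * v3 \<alpha> \<beta> \<epsilon> r * (1 - (v3 \<alpha> \<beta> \<epsilon> r)\<^sup>2) = 0"
proof -
  have "(\<alpha> + \<beta> - 2 * \<alpha> * x r) / \<epsilon>\<^sup>2 = m\<^sup>2 * (1 - 2 * h * x r)"
  proof -
    have "K * (1 - 2 * h * y) = K - 2 * (K * h) * y" for K y :: real
      by algebra
    then have "(\<alpha> + \<beta>) * (1 - 2 * h * x r) = \<alpha> + \<beta> - 2 * \<alpha> * x r"
      by (simp only: h_sum(1))
    then show ?thesis by (simp add: m_sq)
  qed
  then show ?thesis
    unfolding x_def[symmetric] deriv2_eq speed_squared sc by algebra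
qed

lemma planar_equation:
  "v2 \<alpha> \<beta> \<epsilon> r * deriv (deriv (v1 \<alpha> \<beta> \<epsilon>)) r - v1 \<alpha> \<beta> \<epsilon> r * deriv (deriv (v2 \<alpha> \<beta> \<epsilon>)) r = 0"
  by (simp add: deriv2_eq)

lemma angular_momentum:
  "v2 \<alpha> \<beta> \<epsilon> r * deriv (v1 \<alpha> \<beta> \<epsilon>) r - v1 \<alpha> \<beta> \<epsilon> r * deriv (v2 \<alpha> \<beta> \<epsilon>) r
     = - mu \<alpha> \<beta> \<epsilon> * sin (\<epsilon>\<^sup>2)"
proof -
  have "v2 \<alpha> \<beta> \<epsilon> r * deriv (v1 \<alpha> \<beta> \<epsilon>) r - v1 \<alpha> \<beta> \<epsilon> r * deriv (v2 \<alpha> \<beta> \<epsilon>) r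
      = - b r * ((v1 \<alpha> \<beta> \<epsilon> r)\<^sup>2 + (v2 \<alpha> \<beta> \<epsilon> r)\<^sup>2)"
    unfolding deriv_eq by algebra
  also have "\<dots> = - m * s"
    unfolding planar_norm b_def using x_less_1[of r] by simp
  finally show ?thesis
    by (simp add: m_def s_def)
qed

lemma v3_ne_1: "\<bar>v3 \<alpha> \<beta> \<epsilon> r\<bar> \<noteq> 1"
  using x_less_1[of r] unfolding x_def by (metis less_irrefl one_power2 power2_abs)

lemma critical_points_v3:
  assumes "C > 0"
  shows "{r. deriv (v3 \<alpha> \<beta> \<epsilon>) r = 0} = {ln C / (4 * m * c)}"
proof -
  have nz: "4 * m * c \<noteq> 0" using m_pos c_pos by simp
  have ln_iff: "y = C \<longleftrightarrow> ln y = ln C" if "y > 0" for y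
    using that assms by simp
  have "deriv (v3 \<alpha> \<beta> \<epsilon>) r = 0 \<longleftrightarrow> r = ln C / (4 * m * c)" for r
  proof -
    have "deriv (v3 \<alpha> \<beta> \<epsilon>) r = 0 \<longleftrightarrow> (E r)\<^sup>2 = C"
      using v3_pos[of r] m_pos c_pos D_pos[of r] by (simp add: deriv_eq q_def) linarith
    also have "\<dots> \<longleftrightarrow> ln ((E r)\<^sup>2) = ln C"
      using E_pos[of r] by (intro ln_iff) simp
    also have "ln ((E r)\<^sup>2) = r * (4 * m * c)"
      by (simp add: E_def flip: exp_of_nat_mult)
    finally show ?thesis
      by (simp only: nonzero_eq_divide_eq[OF nz])
  qed
  then show ?thesis by auto
qed

text \<open>Multiplying numerator and denominator by \<open>u\<close> leaves \<open>u\<close> and \<open>u E\<close> as the only quantities that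
  can degenerate in the limit; with \<open>u = 1 / E\<close> this handles \<open>E \<rightarrow> \<infinity>\<close>.\<close>
lemma scaled_components:
  assumes "u > 0"
  shows "v1 \<alpha> \<beta> \<epsilon> r = (u * N1 r) / sqrt (u\<^sup>2 * D r)"
    and "v2 \<alpha> \<beta> \<epsilon> r = (u * N2 r) / sqrt (u\<^sup>2 * D r)"
    and "v3 \<alpha> \<beta> \<epsilon> r = sqrt (2 * (\<alpha> + \<beta>)) * c * sqrt (u * (u * E r)) / sqrt (u\<^sup>2 * D r)"
proof -
  have [simp]: "sqrt (u\<^sup>2 * D r) = u * sqrt (D r)"
    using assms by (simp add: real_sqrt_mult)
  have "u * (u * E r) = (u * exp (m * r * c))\<^sup>2"
    by (simp add: E_def power2_eq_square algebra_simps flip: exp_add)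
  then have [simp]: "sqrt (u * (u * E r)) = u * exp (m * r * c)"
    using assms by simp
  show "v1 \<alpha> \<beta> \<epsilon> r = (u * N1 r) / sqrt (u\<^sup>2 * D r)"
    "v2 \<alpha> \<beta> \<epsilon> r = (u * N2 r) / sqrt (u\<^sup>2 * D r)"
    "v3 \<alpha> \<beta> \<epsilon> r = sqrt (2 * (\<alpha> + \<beta>)) * c * sqrt (u * (u * E r)) / sqrt (u\<^sup>2 * D r)"
    using assms by (simp_all add: v1_eq v2_eq v3_eq)
qed

end
section \<open>The limit of vanishing \<open>\<epsilon>\<close>\<close>

lemma eventually_wall_parameters:
  assumes "\<alpha> + \<beta> > 0"
  shows "\<forall>\<^sub>F \<epsilon> in at_right 0. wall_parameters \<alpha> \<beta> \<epsilon>"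
proof -
  have "\<forall>\<^sub>F \<epsilon> :: real in at_right 0. \<epsilon> > 0"
    "\<forall>\<^sub>F \<epsilon> :: real in at_right 0. sin (\<epsilon>\<^sup>2) > 0"
    "\<forall>\<^sub>F \<epsilon> :: real in at_right 0. cos (\<epsilon>\<^sup>2) > 0"
    by real_asymp+
  then show ?thesis
    by eventually_elim (use assms in unfold_locales)
qed

lemma hausdorff_dist_singletons: "hausdorff_dist {y} {z} = ennreal (dist y z)"
  by (simp add: hausdorff_dist_def dist_commute)

text \<open>The logarithm stays bounded because \<open>C\<close> tends to \<open>\<beta>\<^sup>2 / 4\<close>, whereas \<open>1 / \<mu>\<close> is a multiple of \<open>\<epsilon>\<close>.\<close>
lemma critical_point_limit:
  fixes \<alpha> \<beta> :: real
  assumes "\<alpha> + \<beta> > 0" "\<beta> > 0"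
  defines "C \<equiv> \<lambda>\<epsilon>. \<beta>\<^sup>2 / 4 + \<alpha> * (\<alpha> + \<beta>) * (sin (\<epsilon>\<^sup>2))\<^sup>2"
  shows "\<forall>\<^sub>F \<epsilon> in at_right 0. C \<epsilon> > 0"
    and "((\<lambda>\<epsilon>. ln (C \<epsilon>) / (4 * mu \<alpha> \<beta> \<epsilon> * cos (\<epsilon>\<^sup>2))) \<longlongrightarrow> 0) (at_right 0)"
proof -
  have lim: "(C \<longlongrightarrow> \<beta>\<^sup>2 / 4 + \<alpha> * (\<alpha> + \<beta>) * (sin (0\<^sup>2))\<^sup>2) (at_right 0)"
    unfolding C_def by (intro tendsto_intros)
  moreover have pos: "\<beta>\<^sup>2 / 4 > 0" using assms by simp
  ultimately show "\<forall>\<^sub>F \<epsilon> in at_right 0. C \<epsilon> > 0"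
    by (simp add: order_tendstoD)
  have "((\<lambda>\<epsilon>. ln (C \<epsilon>) * \<epsilon> / (4 * sqrt (\<alpha> + \<beta>) * cos (\<epsilon>\<^sup>2))) \<longlongrightarrow>
     ln (\<beta>\<^sup>2 / 4 + \<alpha> * (\<alpha> + \<beta>) * (sin (0\<^sup>2))\<^sup>2) * 0 / (4 * sqrt (\<alpha> + \<beta>) * cos (0\<^sup>2))) (at_right 0)"
    using assms pos by (intro tendsto_intros lim) auto
  then show "((\<lambda>\<epsilon>. ln (C \<epsilon>) / (4 * mu \<alpha> \<beta> \<epsilon> * cos (\<epsilon>\<^sup>2))) \<longlongrightarrow> 0) (at_right 0)"
    by (simp add: mu_def)
qed

text \<open>The limit depends only on the homogeneous coordinates \<open>U : W\<close> of \<open>lim (1 : E)\<close>, because the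
  angle \<open>\<mu> r sin \<epsilon>\<^sup>2\<close> and \<open>sin \<epsilon>\<^sup>2\<close> both tend to 0. The hypothesis on \<open>d\<close> says that the
  limiting denominator does not vanish.\<close>
lemma vcurve_tendsto:
  fixes \<alpha> \<beta> r U W :: real and u :: "real \<Rightarrow> real"
  assumes sum_pos: "\<alpha> + \<beta> > 0"
    and u_pos: "\<And>\<epsilon>. u \<epsilon> > 0"
    and u: "(u \<longlongrightarrow> U) (at_right 0)"
    and w: "((\<lambda>\<epsilon>. u \<epsilon> * exp (2 * mu \<alpha> \<beta> \<epsilon> * r * cos (\<epsilon>\<^sup>2))) \<longlongrightarrow> W) (at_right 0)"
  defines "d \<equiv> W\<^sup>2 + (2 * \<alpha> + \<beta>) * (U * W) + U\<^sup>2 * (\<beta>\<^sup>2 / 4)"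
  assumes d_pos: "d > 0"
  shows "((\<lambda>\<epsilon>. vcurve \<alpha> \<beta> \<epsilon> r) \<longlongrightarrow>
    vector [0, (W - U * (\<beta> / 2)) / sqrt d, sqrt (2 * (\<alpha> + \<beta>)) * sqrt (U * W) / sqrt d]) (at_right 0)"
proof -
  let ?s = "\<lambda>\<epsilon>::real. sin (\<epsilon>\<^sup>2)" and ?c = "\<lambda>\<epsilon>::real. cos (\<epsilon>\<^sup>2)"
  let ?\<theta> = "\<lambda>\<epsilon>. mu \<alpha> \<beta> \<epsilon> * r * ?s \<epsilon>"
  let ?w = "\<lambda>\<epsilon>. u \<epsilon> * exp (2 * mu \<alpha> \<beta> \<epsilon> * r * ?c \<epsilon>)"
  let ?p = "\<lambda>\<epsilon>. ?w \<epsilon> - u \<epsilon> * (\<beta> / 2) + u \<epsilon> * ((\<alpha> + \<beta>) * (?s \<epsilon>)\<^sup>2)"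
  let ?Q = "\<lambda>\<epsilon>. u \<epsilon> * ((\<alpha> + \<beta>) * ?s \<epsilon> * ?c \<epsilon>)"
  let ?d = "\<lambda>\<epsilon>. (?w \<epsilon>)\<^sup>2 + (2 * \<alpha> + \<beta>) * (u \<epsilon> * ?w \<epsilon>)
      + (u \<epsilon>)\<^sup>2 * (\<beta>\<^sup>2 / 4 + \<alpha> * (\<alpha> + \<beta>) * (?s \<epsilon>)\<^sup>2)"
  have s: "(?s \<longlongrightarrow> 0) (at_right 0)" and c: "(?c \<longlongrightarrow> 1) (at_right 0)"
    by real_asymp+
  have \<theta>: "(?\<theta> \<longlongrightarrow> 0) (at_right 0)"
    unfolding mu_def by real_asymp
  have cos_\<theta>: "((\<lambda>\<epsilon>. cos (?\<theta> \<epsilon>)) \<longlongrightarrow> 1) (at_right 0)"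
    and sin_\<theta>: "((\<lambda>\<epsilon>. sin (?\<theta> \<epsilon>)) \<longlongrightarrow> 0) (at_right 0)"
    using tendsto_cos[OF \<theta>] tendsto_sin[OF \<theta>] by simp_all
  have p: "(?p \<longlongrightarrow> W - U * (\<beta> / 2) + U * ((\<alpha> + \<beta>) * 0\<^sup>2)) (at_right 0)"
    by (intro tendsto_intros u w s)
  have Q: "(?Q \<longlongrightarrow> U * ((\<alpha> + \<beta>) * 0 * 1)) (at_right 0)"
    by (intro tendsto_intros u s c)
  have "(?d \<longlongrightarrow> W\<^sup>2 + (2 * \<alpha> + \<beta>) * (U * W)
      + U\<^sup>2 * (\<beta>\<^sup>2 / 4 + \<alpha> * (\<alpha> + \<beta>) * 0\<^sup>2)) (at_right 0)"
    by (intro tendsto_intros u w s)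
  then have sqrt_d: "((\<lambda>\<epsilon>. sqrt (?d \<epsilon>)) \<longlongrightarrow> sqrt d) (at_right 0)"
    by (intro tendsto_intros) (simp add: d_def)
  have nz: "sqrt d \<noteq> 0" using d_pos by simp
  have "((\<lambda>\<epsilon>. vector
      [(?Q \<epsilon> * cos (?\<theta> \<epsilon>) - ?p \<epsilon> * sin (?\<theta> \<epsilon>)) / sqrt (?d \<epsilon>),
       (?p \<epsilon> * cos (?\<theta> \<epsilon>) + ?Q \<epsilon> * sin (?\<theta> \<epsilon>)) / sqrt (?d \<epsilon>),
       sqrt (2 * (\<alpha> + \<beta>)) * ?c \<epsilon> * sqrt (u \<epsilon> * ?w \<epsilon>) / sqrt (?d \<epsilon>)] :: real ^ 3) \<longlongrightarrow>
    vector
      [(U * ((\<alpha> + \<beta>) * 0 * 1) * 1 - (W - U * (\<beta> / 2) + U * ((\<alpha> + \<beta>) * 0\<^sup>2)) * 0) / sqrt d,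
       ((W - U * (\<beta> / 2) + U * ((\<alpha> + \<beta>) * 0\<^sup>2)) * 1 + U * ((\<alpha> + \<beta>) * 0 * 1) * 0) / sqrt d,
       sqrt (2 * (\<alpha> + \<beta>)) * 1 * sqrt (U * W) / sqrt d]) (at_right 0)"
    by (intro tendsto_vector_3 tendsto_divide tendsto_diff tendsto_add tendsto_mult
        tendsto_real_sqrt tendsto_const p Q cos_\<theta> sin_\<theta> sqrt_d c u w nz)
  moreover have "\<forall>\<^sub>F \<epsilon> in at_right 0. vcurve \<alpha> \<beta> \<epsilon> r = vector
      [(?Q \<epsilon> * cos (?\<theta> \<epsilon>) - ?p \<epsilon> * sin (?\<theta> \<epsilon>)) / sqrt (?d \<epsilon>),
       (?p \<epsilon> * cos (?\<theta> \<epsilon>) + ?Q \<epsilon> * sin (?\<theta> \<epsilon>)) / sqrt (?d \<epsilon>),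
       sqrt (2 * (\<alpha> + \<beta>)) * ?c \<epsilon> * sqrt (u \<epsilon> * ?w \<epsilon>) / sqrt (?d \<epsilon>)]"
    using eventually_wall_parameters[OF sum_pos]
  proof eventually_elim
    case (elim \<epsilon>)
    then interpret wall_parameters \<alpha> \<beta> \<epsilon> .
    have E: "?w \<epsilon> = u \<epsilon> * E r" and \<theta>': "?\<theta> \<epsilon> = \<theta> r"
      and sc': "?s \<epsilon> = s" "?c \<epsilon> = c"
      by (simp_all add: E_def \<theta>_def m_def s_def c_def)
    have "(u \<epsilon>)\<^sup>2 * D r = (u \<epsilon> * E r)\<^sup>2 + (2 * \<alpha> + \<beta>) * (u \<epsilon> * (u \<epsilon> * E r))
        + (u \<epsilon>)\<^sup>2 * (\<beta>\<^sup>2 / 4 + \<alpha> * (\<alpha> + \<beta>) * s\<^sup>2)"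
      unfolding D_def C_def by algebra
    moreover have "u \<epsilon> * N1 r = u \<epsilon> * ((\<alpha> + \<beta>) * s * c) * cos (\<theta> r)
        - (u \<epsilon> * E r - u \<epsilon> * (\<beta> / 2) + u \<epsilon> * ((\<alpha> + \<beta>) * s\<^sup>2)) * sin (\<theta> r)"
      "u \<epsilon> * N2 r = (u \<epsilon> * E r - u \<epsilon> * (\<beta> / 2) + u \<epsilon> * ((\<alpha> + \<beta>) * s\<^sup>2)) * cos (\<theta> r)
        + u \<epsilon> * ((\<alpha> + \<beta>) * s * c) * sin (\<theta> r)"
      unfolding N1_def N2_def P_def Q_def by algebra+
    ultimately show ?case
      unfolding vcurve_def scaled_components[OF u_pos[of \<epsilon>]] unfolding E \<theta>' unfolding sc'
      by (simp only:)
  qed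
  ultimately show ?thesis
    by (simp add: tendsto_cong)
qed

text \<open>The three cases are \<open>U : W\<close> equal to \<open>0 : 1\<close>, \<open>1 : 1\<close> and \<open>1 : 0\<close>. In the last one the second component
  tends to \<open>- (\<beta> / 2) / sqrt (\<beta>\<^sup>2 / 4)\<close>, which is \<open>-1\<close> because \<open>\<beta>\<close> is positive.\<close>
lemma vcurve_limit:
  fixes \<alpha> \<beta> r :: real
  assumes "\<alpha> + \<beta> > 0" "\<beta> > 0"
  shows "((\<lambda>\<epsilon>. vcurve \<alpha> \<beta> \<epsilon> r) \<longlongrightarrow>
    (if r > 0 then vector [0, 1, 0]
     else if r = 0 then
       vector [0, (2 - \<beta>) / sqrt (8 * \<alpha> + (2 + \<beta>)\<^sup>2),
               2 * sqrt 2 * sqrt (\<alpha> + \<beta>) / sqrt (8 * \<alpha> + (2 + \<beta>)\<^sup>2)]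
     else vector [0, -1, 0])) (at_right 0)"
proof -
  define k where "k = sqrt (\<alpha> + \<beta>)"
  have k: "k > 0" using assms by (simp add: k_def)
  have decay: "((\<lambda>\<epsilon>. exp (- (2 * mu \<alpha> \<beta> \<epsilon> * t * cos (\<epsilon>\<^sup>2)))) \<longlongrightarrow> 0) (at_right 0)"
    if "t > 0" for t
    unfolding mu_def k_def[symmetric] using k that by real_asymp
  consider "r > 0" | "r = 0" | "r < 0" by linarith
  then show ?thesis
  proof cases
    case 1
    let ?u = "\<lambda>\<epsilon>. exp (- (2 * mu \<alpha> \<beta> \<epsilon> * r * cos (\<epsilon>\<^sup>2)))"
    have "(?u \<longlongrightarrow> 0) (at_right 0)"
      using decay[OF 1] .
    moreover have "((\<lambda>\<epsilon>. ?u \<epsilon> * exp (2 * mu \<alpha> \<beta> \<epsilon> * r * cos (\<epsilon>\<^sup>2))) \<longlongrightarrow> 1) (at_right 0)"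
      by (simp flip: exp_add)
    ultimately show ?thesis
      using vcurve_tendsto[OF assms(1), of ?u 0 r 1] 1 by simp
  next
    case 2
    have d: "1 + (2 * \<alpha> + \<beta>) + \<beta>\<^sup>2 / 4 = (8 * \<alpha> + (2 + \<beta>)\<^sup>2) / 4"
      by (simp add: power2_eq_square algebra_simps)
    have "0 < 8 * (\<alpha> + \<beta>) + (2 - \<beta>)\<^sup>2"
      using assms(1) by (intro add_pos_nonneg) simp_all
    also have "\<dots> = 8 * \<alpha> + (2 + \<beta>)\<^sup>2"
      by (simp add: power2_eq_square algebra_simps)
    finally have pos: "8 * \<alpha> + (2 + \<beta>)\<^sup>2 > 0" .
    have d_pos: "1 + (2 * \<alpha> + \<beta>) + \<beta>\<^sup>2 / 4 > 0"
      unfolding d using pos by simp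
    have sqrt_d: "sqrt (1 + (2 * \<alpha> + \<beta>) + \<beta>\<^sup>2 / 4) = sqrt (8 * \<alpha> + (2 + \<beta>)\<^sup>2) / 2"
      unfolding d real_sqrt_divide by simp
    have "(1 - \<beta> / 2) / sqrt (1 + (2 * \<alpha> + \<beta>) + \<beta>\<^sup>2 / 4)
        = (2 - \<beta>) / sqrt (8 * \<alpha> + (2 + \<beta>)\<^sup>2)"
      "sqrt (2 * (\<alpha> + \<beta>)) / sqrt (1 + (2 * \<alpha> + \<beta>) + \<beta>\<^sup>2 / 4)
        = 2 * sqrt 2 * sqrt (\<alpha> + \<beta>) / sqrt (8 * \<alpha> + (2 + \<beta>)\<^sup>2)"
      unfolding sqrt_d real_sqrt_mult using pos by (simp_all add: field_simps)
    then show ?thesis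
      using vcurve_tendsto[OF assms(1), of "\<lambda>_. 1" 1 r 1] d_pos 2
      by simp
  next
    case 3
    have "((\<lambda>\<epsilon>. exp (2 * mu \<alpha> \<beta> \<epsilon> * r * cos (\<epsilon>\<^sup>2))) \<longlongrightarrow> 0) (at_right 0)"
      using decay[of "- r"] 3 by simp
    moreover have "\<beta> / (2 * sqrt (\<beta>\<^sup>2 / 4)) = 1"
      using assms by (simp add: real_sqrt_divide)
    ultimately show ?thesis
      using vcurve_tendsto[OF assms(1), of "\<lambda>_. 1" 1 r 0] 3 assms(2) by simp
  qed
qed

theorem lemma4p1:
  fixes \<alpha> \<beta> :: real
  assumes "\<alpha> + \<beta> > 0" and "\<beta> > 0"
  shows
    "(\<forall>\<^sub>F \<epsilon> in at_right 0.
        C2_on_reals (vcurve \<alpha> \<beta> \<epsilon>)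
        \<and> (\<forall>r. vcurve \<alpha> \<beta> \<epsilon> r \<in> sphere 0 1)
        \<and> (\<forall>r. v2 \<alpha> \<beta> \<epsilon> r * deriv (deriv (v1 \<alpha> \<beta> \<epsilon>)) r
               - v1 \<alpha> \<beta> \<epsilon> r * deriv (deriv (v2 \<alpha> \<beta> \<epsilon>)) r = 0)
        \<and> (\<forall>r. deriv (deriv (v3 \<alpha> \<beta> \<epsilon>)) r
               + (norm (vector_derivative (vcurve \<alpha> \<beta> \<epsilon>) (at r)))\<^sup>2 * v3 \<alpha> \<beta> \<epsilon> r
               - (\<alpha> + \<beta> - 2 * \<alpha> * (v3 \<alpha> \<beta> \<epsilon> r)\<^sup>2) / \<epsilon>\<^sup>2
                 * v3 \<alpha> \<beta> \<epsilon> r * (1 - (v3 \<alpha> \<beta> \<epsilon> r)\<^sup>2) = 0))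
     \<and> ((\<forall>\<^sub>F \<epsilon> in at_right 0. {r. deriv (v3 \<alpha> \<beta> \<epsilon>) r = 0} \<noteq> {})
        \<and> ((\<lambda>\<epsilon>. hausdorff_dist {r. deriv (v3 \<alpha> \<beta> \<epsilon>) r = 0} {0}) \<longlongrightarrow> 0) (at_right 0))
     \<and> (\<forall>\<^sub>F \<epsilon> in at_right 0. \<forall>r. \<bar>v3 \<alpha> \<beta> \<epsilon> r\<bar> \<noteq> 1)
     \<and> (\<forall>\<^sub>F \<epsilon> in at_right 0. \<forall>r.
          v2 \<alpha> \<beta> \<epsilon> r * deriv (v1 \<alpha> \<beta> \<epsilon>) r - v1 \<alpha> \<beta> \<epsilon> r * deriv (v2 \<alpha> \<beta> \<epsilon>) r
            = - mu \<alpha> \<beta> \<epsilon> * sin (\<epsilon>\<^sup>2)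
          \<and> - mu \<alpha> \<beta> \<epsilon> * sin (\<epsilon>\<^sup>2) \<noteq> 0)
     \<and> (\<forall>\<^sub>F \<epsilon> in at_right 0. \<forall>r.
          v2 \<alpha> \<beta> \<epsilon> r * deriv (deriv (v1 \<alpha> \<beta> \<epsilon>)) r
          - v1 \<alpha> \<beta> \<epsilon> r * deriv (deriv (v2 \<alpha> \<beta> \<epsilon>)) r = 0)
     \<and> (\<forall>r. ((\<lambda>\<epsilon>. vcurve \<alpha> \<beta> \<epsilon> r) \<longlongrightarrow>
          (if r > 0 then vector [0, 1, 0]
           else if r = 0 then
             vector [0, (2 - \<beta>) / sqrt (8 * \<alpha> + (2 + \<beta>)\<^sup>2),
                     2 * sqrt 2 * sqrt (\<alpha> + \<beta>) / sqrt (8 * \<alpha> + (2 + \<beta>)\<^sup>2)]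
           else vector [0, -1, 0])) (at_right 0))"
proof (intro conjI)
  note ev = eventually_wall_parameters[OF assms(1)]
  show "\<forall>\<^sub>F \<epsilon> in at_right 0.
        C2_on_reals (vcurve \<alpha> \<beta> \<epsilon>)
        \<and> (\<forall>r. vcurve \<alpha> \<beta> \<epsilon> r \<in> sphere 0 1)
        \<and> (\<forall>r. v2 \<alpha> \<beta> \<epsilon> r * deriv (deriv (v1 \<alpha> \<beta> \<epsilon>)) r
               - v1 \<alpha> \<beta> \<epsilon> r * deriv (deriv (v2 \<alpha> \<beta> \<epsilon>)) r = 0)
        \<and> (\<forall>r. deriv (deriv (v3 \<alpha> \<beta> \<epsilon>)) r
               + (norm (vector_derivative (vcurve \<alpha> \<beta> \<epsilon>) (at r)))\<^sup>2 * v3 \<alpha> \<beta> \<epsilon> r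
               - (\<alpha> + \<beta> - 2 * \<alpha> * (v3 \<alpha> \<beta> \<epsilon> r)\<^sup>2) / \<epsilon>\<^sup>2
                 * v3 \<alpha> \<beta> \<epsilon> r * (1 - (v3 \<alpha> \<beta> \<epsilon> r)\<^sup>2) = 0)"
    using ev
  proof eventually_elim
    case (elim \<epsilon>)
    then interpret wall_parameters \<alpha> \<beta> \<epsilon> .
    show ?case
      by (intro conjI allI C2_vcurve vcurve_sphere planar_equation v3_equation)
  qed
  let ?C = "\<lambda>\<epsilon>. \<beta>\<^sup>2 / 4 + \<alpha> * (\<alpha> + \<beta>) * (sin (\<epsilon>\<^sup>2))\<^sup>2"
  let ?r = "\<lambda>\<epsilon>. ln (?C \<epsilon>) / (4 * mu \<alpha> \<beta> \<epsilon> * cos (\<epsilon>\<^sup>2))"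
  have zeros: "\<forall>\<^sub>F \<epsilon> in at_right 0. {r. deriv (v3 \<alpha> \<beta> \<epsilon>) r = 0} = {?r \<epsilon>}"
    using ev critical_point_limit(1)[OF assms]
  proof eventually_elim
    case (elim \<epsilon>)
    then interpret wall_parameters \<alpha> \<beta> \<epsilon> by simp
    show ?case
      using critical_points_v3 elim(2) by (simp add: C_def m_def s_def c_def)
  qed
  then show "\<forall>\<^sub>F \<epsilon> in at_right 0. {r. deriv (v3 \<alpha> \<beta> \<epsilon>) r = 0} \<noteq> {}"
    by eventually_elim simp
  have "((\<lambda>\<epsilon>. ennreal (dist (?r \<epsilon>) 0)) \<longlongrightarrow> ennreal (dist 0 (0::real))) (at_right 0)"
    by (intro tendsto_intros critical_point_limit(2) assms)
  moreover have "\<forall>\<^sub>F \<epsilon> in at_right 0.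
      hausdorff_dist {r. deriv (v3 \<alpha> \<beta> \<epsilon>) r = 0} {0} = ennreal (dist (?r \<epsilon>) 0)"
    using zeros by eventually_elim (simp only: hausdorff_dist_singletons)
  ultimately show
    "((\<lambda>\<epsilon>. hausdorff_dist {r. deriv (v3 \<alpha> \<beta> \<epsilon>) r = 0} {0}) \<longlongrightarrow> 0) (at_right 0)"
    by (simp add: tendsto_cong)
  show "\<forall>\<^sub>F \<epsilon> in at_right 0. \<forall>r. \<bar>v3 \<alpha> \<beta> \<epsilon> r\<bar> \<noteq> 1"
    using ev by eventually_elim (simp add: wall_parameters.v3_ne_1)
  show "\<forall>\<^sub>F \<epsilon> in at_right 0. \<forall>r.
          v2 \<alpha> \<beta> \<epsilon> r * deriv (v1 \<alpha> \<beta> \<epsilon>) r - v1 \<alpha> \<beta> \<epsilon> r * deriv (v2 \<alpha> \<beta> \<epsilon>) r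
            = - mu \<alpha> \<beta> \<epsilon> * sin (\<epsilon>\<^sup>2)
          \<and> - mu \<alpha> \<beta> \<epsilon> * sin (\<epsilon>\<^sup>2) \<noteq> 0"
    using ev
  proof eventually_elim
    case (elim \<epsilon>)
    then interpret wall_parameters \<alpha> \<beta> \<epsilon> .
    have "- mu \<alpha> \<beta> \<epsilon> * sin (\<epsilon>\<^sup>2) \<noteq> 0"
      using m_pos s_pos by (simp add: m_def s_def)
    then show ?case
      using angular_momentum by blast
  qed
  show "\<forall>\<^sub>F \<epsilon> in at_right 0. \<forall>r.
          v2 \<alpha> \<beta> \<epsilon> r * deriv (deriv (v1 \<alpha> \<beta> \<epsilon>)) r
          - v1 \<alpha> \<beta> \<epsilon> r * deriv (deriv (v2 \<alpha> \<beta> \<epsilon>)) r = 0"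
    using ev by eventually_elim (simp add: wall_parameters.planar_equation)
qed (intro allI vcurve_limit assms)

end
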